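(* Let $x\in(0,1)$ and let $N\ge 1$ be an integer. Then $$\log(x)=\max\left\{\log_{\{t_n\}}(x)\ :\ \{t_n\}_{n\in\mathbb{Z}}\text{ a sequence of pairwise distinct real numbers with } t_{n+N}-t_n=N\ \text{ for all } n\in\mathbb{Z}\right\},$$ and this maximum is achieved by $\{t_n\}_{n\in\mathbb{Z}}$ if and only if $\{t_n: n\in\mathbb{Z}\}=\mathbb{Z}+a$ (as sets) for some $a\in\mathbb{R}$.
   Context: For an integer $N\ge1$, a sequence $\{t_n\}_{n\in\mathbb{Z}}$ of pairwise distinct real numbers is called $N$-periodic if $t_{n+N}-t_n=N$ for all $n\in\mathbb{Z}$. For such a sequence, the $\{t_n\}$-logarithm of $x\in(0,1)$ is $$\log_{\{t_n\}}(x):=-\frac{1}{2N}\sum_{i=1}^N\ \sum_{j\in\mathbb{Z}\setminus\{i\}}\frac{(1-x)^{|t_j-t_i|}}{|t_j-t_i|}.$$ Here $\log$ is the natural logarithm. *)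

theory Defs
  imports "HOL-Analysis.Analysis"
begin

definition periodic_seq :: "nat \<Rightarrow> (int \<Rightarrow> real) \<Rightarrow> bool" where
  "periodic_seq N t \<longleftrightarrow> inj t \<and> (\<forall>n. t (n + int N) - t n = real N)"

text \<open>
  The inner series has nonnegative terms and converges for \<open>0 < x < 1\<close> and \<open>periodic_seq N t\<close>
  with \<open>N \<ge> 1\<close>, since each residue class of indices modulo \<open>N\<close> contributes two geometrically
  decaying tails. So \<open>infsum\<close> does not take its default value 0 there.
\<close>

definition seq_log :: "nat \<Rightarrow> (int \<Rightarrow> real) \<Rightarrow> real \<Rightarrow> real" where
  "seq_log N t x =
     - (1 / (2 * real N)) *
       (\<Sum>i\<in>{1..int N}. \<Sum>\<^sub>\<infinity>j\<in>UNIV - {i}. (1 - x) powr \<bar>t j - t i\<bar> / \<bar>t j - t i\<bar>)"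

definition is_maximum :: "real \<Rightarrow> real set \<Rightarrow> bool" where
  "is_maximum m S \<longleftrightarrow> m \<in> S \<and> (\<forall>y\<in>S. y \<le> m)"

end

theory Submission
  imports Defs
begin

text \<open>
  Put \<open>q = 1 - x\<close> and \<open>\<phi> d = q powr d / d\<close> for \<open>d > 0\<close>.  Up to the factor \<open>-1 / (2 N)\<close>, the
  quantity \<open>seq_log N t x\<close> is the interaction energy of a point configuration on the line that is
  invariant under translation by \<open>N\<close>: each of the \<open>N\<close> points in one period interacts with all
  others through the repulsive potential \<open>\<phi>\<close>.  The claim is that equal spacing minimises it.

  The energy depends on the set of points only, not on their numbering
  (\<open>seq_log_cong_range\<close>), so the points may be numbered increasingly, as \<open>s\<close>
  (\<open>periodic_seq_sorted\<close>).  Pairs of points are then grouped by the difference \<open>k\<close> of their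
  indices; the left and right neighbours at index distance \<open>k\<close> contribute equally, which leaves
  \<open>N * (- seq_log N s x) = (\<Sum>k\<ge>1. \<Sum>i=1..N. \<phi> (s (i + k) - s i))\<close> (\<open>has_sum_seq_log\<close>).
  For fixed \<open>k\<close> the \<open>N\<close> distances \<open>s (i + k) - s i\<close> have mean exactly \<open>k\<close>, by periodicity
  (\<open>sum_spacing\<close>).  Since \<open>\<phi>\<close> is strictly convex, Jensen's inequality bounds the inner sum below
  by \<open>N * \<phi> k\<close>, and \<open>(\<Sum>k\<ge>1. \<phi> k) = (\<Sum>k\<ge>1. q ^ k / k) = - ln x\<close>.  This is the upper bound
  \<open>ln x\<close>.  Equality forces equality in Jensen for \<open>k = 1\<close>, hence all consecutive gaps are \<open>1\<close> and
  the points form a translate of the integers; for such a translate every step is an equality.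
\<close>

section \<open>The pair potential\<close>

definition pair_energy :: "real \<Rightarrow> real \<Rightarrow> real" where
  "pair_energy q d = q powr d / d"

lemma pair_energy_nonneg: "0 \<le> d \<Longrightarrow> 0 \<le> pair_energy q d"
  by (simp add: pair_energy_def)

lemma pair_energy_of_nat: "0 < q \<Longrightarrow> pair_energy q (real k) = q ^ k / real k"
  by (simp add: pair_energy_def powr_realpow)

text \<open>
  The strict convexity of the potential, in the form in which Jensen's inequality uses it: its
  graph lies above the tangent at \<open>c\<close>, which has slope \<open>\<phi> c * (ln q - 1 / c)\<close>.  Since
  \<open>\<phi> d / \<phi> c = exp y\<close> with \<open>y = (d - c) * ln q - ln (d / c)\<close>, the inequalities \<open>1 + y \<le> exp y\<close>
  and \<open>ln (d / c) \<le> d / c - 1\<close> suffice, and the latter is strict unless \<open>d = c\<close>.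
\<close>

lemma pair_energy_tangent:
  assumes "0 < q" "0 < c" "0 < d"
  shows "pair_energy q c * (1 + (ln q - 1 / c) * (d - c)) \<le> pair_energy q d"
    and "pair_energy q c * (1 + (ln q - 1 / c) * (d - c)) = pair_energy q d \<Longrightarrow> d = c"
proof -
  define y where "y = (d - c) * ln q - ln (d / c)"
  have pos: "0 < pair_energy q c"
    using assms by (simp add: pair_energy_def)
  have eq: "pair_energy q d = pair_energy q c * exp y"
    using assms by (simp add: y_def pair_energy_def powr_def exp_diff left_diff_distrib)
  have exp_bound: "1 + y \<le> exp y"
    by simp
  have ln_bound: "ln (d / c) \<le> d / c - 1"
    using assms by (intro ln_le_minus_one) simp
  have slope: "1 + (ln q - 1 / c) * (d - c) = 1 + y + (ln (d / c) - (d / c - 1))"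
    using assms by (simp add: y_def field_simps)
  show "pair_energy q c * (1 + (ln q - 1 / c) * (d - c)) \<le> pair_energy q d"
    unfolding eq using pos exp_bound ln_bound slope by (intro mult_left_mono) linarith+
  assume "pair_energy q c * (1 + (ln q - 1 / c) * (d - c)) = pair_energy q d"
  then have "1 + (ln q - 1 / c) * (d - c) = exp y"
    unfolding eq using pos by simp
  then have "ln (d / c) = d / c - 1"
    using exp_bound ln_bound slope by linarith
  then have "d / c = 1"
    using assms by (intro ln_eq_minus_one) simp_all
  then show "d = c"
    using assms by simp
qed

lemma pair_energy_has_sum:
  assumes "0 < q" "q < 1"
  shows "((\<lambda>k. pair_energy q (real k)) has_sum (- ln (1 - q))) {1..}"
proof -
  have "(\<lambda>k. - ((- (- q)) ^ k) / real k) sums ln (1 + - q)"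
    using assms by (intro ln_series') simp
  from sums_minus[OF this] have "(\<lambda>k. q ^ k / real k) sums (- ln (1 - q))"
    by simp
  then have "((\<lambda>k. q ^ k / real k) has_sum (- ln (1 - q))) UNIV"
    using assms by (intro sums_nonneg_imp_has_sum) auto
  \<comment> \<open>The term at \<open>k = 0\<close> is a division by zero, which has the value \<open>0\<close>.\<close>
  also have "?this \<longleftrightarrow> ?thesis"
    using assms by (intro has_sum_cong_neutral) (auto simp: pair_energy_of_nat)
  finally show ?thesis .
qed


section \<open>Periodic sequences\<close>

lemma periodic_seq_inj: "periodic_seq N t \<Longrightarrow> inj t"
  by (simp add: periodic_seq_def)

lemma periodic_seq_shift:
  assumes "periodic_seq N t"
  shows "t (n + m * int N) = t n + of_int m * real N"
proof (induction m rule: int_induct[where k = 0])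
  case (step1 m)
  have "t (n + m * int N + int N) = t (n + m * int N) + real N"
    using assms unfolding periodic_seq_def by (metis diff_eq_eq add.commute)
  then show ?case
    using step1 by (simp add: algebra_simps)
next
  case (step2 m)
  have "t (n + (m - 1) * int N + int N) = t (n + (m - 1) * int N) + real N"
    using assms unfolding periodic_seq_def by (metis diff_eq_eq add.commute)
  then show ?case
    using step2 by (simp add: algebra_simps)
qed simp

lemma periodic_seq_range_shift:
  assumes "periodic_seq N t" "v \<in> range t"
  shows "v + of_int m * real N \<in> range t"
  using assms(2) periodic_seq_shift[OF assms(1), symmetric] by auto

text \<open>
  Reflection at the origin exchanges left and right neighbours and so transfers estimates from
  one side to the other.
\<close>

lemma periodic_seq_reflect:
  assumes "periodic_seq N t"
  shows "periodic_seq N (\<lambda>n. - t (- n))"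
  unfolding periodic_seq_def
proof (intro conjI allI)
  show "inj (\<lambda>n. - t (- n))"
    using periodic_seq_inj[OF assms] by (simp add: inj_def) (metis minus_minus)
  fix n
  show "- t (- (n + int N)) - - t (- n) = real N"
    using periodic_seq_shift[OF assms, of "- n" "- 1"] by simp
qed

lemma int_period_decomposition:
  assumes "N \<ge> 1"
  obtains j m where "j \<in> {1..int N}" "i = j + m * int N"
proof
  have "(i - 1) mod int N < int N" "0 \<le> (i - 1) mod int N"
    using assms by simp_all
  then show "(i - 1) mod int N + 1 \<in> {1..int N}"
    by simp
  show "i = (i - 1) mod int N + 1 + (i - 1) div int N * int N"
    by simp
qed

lemma sum_telescope_int:
  fixes f :: "int \<Rightarrow> 'a :: ab_group_add"
  shows "(\<Sum>i\<in>{1..int n}. f (i + 1) - f i) = f (int n + 1) - f 1"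
proof (induction n)
  case (Suc n)
  have "{1..int (Suc n)} = insert (int n + 1) {1..int n}"
    by auto
  then show ?case
    using Suc by (simp add: algebra_simps)
qed simp

lemma sum_periodic_shift:
  fixes g :: "int \<Rightarrow> real"
  assumes "\<And>i. g (i + int N) = g i"
  shows "(\<Sum>i\<in>{1..int N}. g (i + k)) = (\<Sum>i\<in>{1..int N}. g i)"
proof -
  have step: "(\<Sum>i\<in>{1..int N}. g (i + (k + 1))) = (\<Sum>i\<in>{1..int N}. g (i + k))" for k
  proof -
    have "(\<Sum>i\<in>{1..int N}. g (i + (k + 1)) - g (i + k)) = g (int N + 1 + k) - g (1 + k)"
      using sum_telescope_int[of "\<lambda>i. g (i + k)" N] by (simp add: ac_simps)
    also have "g (int N + 1 + k) = g (1 + k)"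
      using assms[of "1 + k"] by (simp add: algebra_simps)
    finally show ?thesis
      by (simp add: sum_subtractf)
  qed
  show ?thesis
  proof (induction k rule: int_induct[where k = 0])
    case (step2 k)
    then show ?case
      using step[of "k - 1"] by simp
  qed (simp_all add: step)
qed

text \<open>
  The mean of the distances between points at index distance \<open>k\<close> is \<open>k\<close>, however the points are
  placed: increasing \<open>k\<close> by one adds every gap of one period once, and those gaps sum to \<open>N\<close>.
\<close>

lemma sum_spacing:
  assumes "periodic_seq N t"
  shows "(\<Sum>i\<in>{1..int N}. t (i + int k) - t i) = real N * real k"
proof (induction k)
  case (Suc k)
  define g where "g = (\<lambda>i. t (i + 1) - t i)"
  have "g (i + int N) = g i" for i
    using periodic_seq_shift[OF assms, of "i + 1" 1] periodic_seq_shift[OF assms, of i 1]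
    by (simp add: g_def algebra_simps)
  then have "(\<Sum>i\<in>{1..int N}. g (i + int k)) = (\<Sum>i\<in>{1..int N}. g i)"
    by (rule sum_periodic_shift)
  also have "\<dots> = t (int N + 1) - t 1"
    unfolding g_def by (rule sum_telescope_int)
  also have "t (int N + 1) - t 1 = real N"
    using periodic_seq_shift[OF assms, of 1 1] by (simp add: add.commute)
  finally have gaps: "(\<Sum>i\<in>{1..int N}. g (i + int k)) = real N"
    by simp
  have "(\<Sum>i\<in>{1..int N}. t (i + int (Suc k)) - t i)
      = (\<Sum>i\<in>{1..int N}. t (i + int k) - t i) + (\<Sum>i\<in>{1..int N}. g (i + int k))"
    by (simp add: g_def sum.distrib[symmetric] algebra_simps)
  then show ?case
    using Suc gaps by (simp add: algebra_simps)
qed simp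


section \<open>Renumbering the points\<close>

text \<open>
  Every point is moved into the window \<open>[0, N)\<close> by exactly one multiple of \<open>N\<close>.  Points whose
  indices differ by a multiple of \<open>N\<close> arrive at the same place, all others stay distinct.
\<close>

lemma bij_betw_period_window:
  assumes "N \<ge> 1" "periodic_seq N t"
  shows "bij_betw (\<lambda>i. t i - of_int \<lfloor>t i / real N\<rfloor> * real N)
           {1..int N} (range t \<inter> {0..<real N})"
    (is "bij_betw ?r _ _")
  unfolding bij_betw_def
proof (intro conjI subset_antisym subsetI)
  have N: "0 < real N"
    using assms(1) by simp
  have r_eq: "?r i = t (i + (- \<lfloor>t i / real N\<rfloor>) * int N)" for i
    using periodic_seq_shift[OF assms(2), of i "- \<lfloor>t i / real N\<rfloor>"] by simp
  show "inj_on ?r {1..int N}"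
  proof (rule inj_onI)
    fix i j assume ij: "i \<in> {1..int N}" "j \<in> {1..int N}" and "?r i = ?r j"
    then have "i + (- \<lfloor>t i / real N\<rfloor>) * int N = j + (- \<lfloor>t j / real N\<rfloor>) * int N"
      unfolding r_eq using periodic_seq_inj[OF assms(2)] by (simp only: inj_eq)
    then have "i - j = (\<lfloor>t i / real N\<rfloor> - \<lfloor>t j / real N\<rfloor>) * int N"
      by (simp add: algebra_simps)
    then have "int N dvd i - j"
      by simp
    moreover have "\<bar>i - j\<bar> < int N"
      using ij by auto
    ultimately show "i = j"
      using zdvd_not_zless[of "\<bar>i - j\<bar>" "int N"] by force
  qed
  fix u
  show "u \<in> range t \<inter> {0..<real N}" if "u \<in> ?r ` {1..int N}"
  proof -
    obtain i where u: "u = ?r i"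
      using \<open>u \<in> _\<close> by blast
    have "0 \<le> u" "u < real N"
      using floor_divide_lower[OF N, of "t i"] floor_divide_upper[OF N, of "t i"]
      unfolding u by (simp_all add: algebra_simps)
    then show ?thesis
      using u r_eq by auto
  qed
  show "u \<in> ?r ` {1..int N}" if "u \<in> range t \<inter> {0..<real N}"
  proof -
    obtain n where n: "u = t n" and u: "0 \<le> u" "u < real N"
      using \<open>u \<in> range t \<inter> {0..<real N}\<close> by auto
    obtain i m where i: "i \<in> {1..int N}" and "n = i + m * int N"
      using int_period_decomposition[OF assms(1)] .
    then have ti: "t i = u - of_int m * real N"
      using n periodic_seq_shift[OF assms(2), of i m] by simp
    have "\<lfloor>t i / real N\<rfloor> = - m"
      using u N by (intro floor_unique) (simp_all add: ti field_simps)
    then have "?r i = u"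
      by (simp add: ti)
    then show ?thesis
      using i by blast
  qed
qed

lemma sum_over_period:
  fixes G :: "real \<Rightarrow> real"
  assumes "N \<ge> 1" "periodic_seq N t"
    and G: "\<And>i m. G (t i + of_int m * real N) = G (t i)"
  shows "(\<Sum>i\<in>{1..int N}. G (t i)) = (\<Sum>u\<in>range t \<inter> {0..<real N}. G u)"
proof -
  have "(\<Sum>i\<in>{1..int N}. G (t i)) = (\<Sum>i\<in>{1..int N}. G (t i - of_int \<lfloor>t i / real N\<rfloor> * real N))"
    using G[of _ "- \<lfloor>_ / real N\<rfloor>"] by simp
  also have "\<dots> = (\<Sum>u\<in>range t \<inter> {0..<real N}. G u)"
    by (rule sum.reindex_bij_betw[OF bij_betw_period_window[OF assms(1,2)]])
  finally show ?thesis .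
qed

text \<open>
  The interaction of one point with all the others is a function of its position that is
  \<open>N\<close>-periodic and only involves the set of points, so its sum over one period only involves the
  points in \<open>[0, N)\<close>.
\<close>

lemma seq_log_cong_range:
  assumes "N \<ge> 1" "periodic_seq N t" "periodic_seq N s" "range t = range s"
  shows "seq_log N t x = seq_log N s x"
proof -
  define f where "f = (\<lambda>d. (1 - x) powr \<bar>d\<bar> / \<bar>d\<bar>)"
  define G where "G = (\<lambda>p. \<Sum>\<^sub>\<infinity>v\<in>range t - {p}. f (v - p))"
  have G_shift: "G (p + of_int m * real N) = G p" for p m
  proof -
    let ?c = "of_int m * real N"
    have "range t - {p + ?c} = (\<lambda>v. v + ?c) ` (range t - {p})"
    proof (intro subset_antisym subsetI)
      fix v assume "v \<in> range t - {p + ?c}"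
      then have "v - ?c \<in> range t - {p}"
        using periodic_seq_range_shift[OF assms(2), of v "- m"] by auto
      then show "v \<in> (\<lambda>v. v + ?c) ` (range t - {p})"
        by (intro image_eqI[where x = "v - ?c"]) simp_all
    qed (use periodic_seq_range_shift[OF assms(2)] in auto)
    then show ?thesis
      unfolding G_def by (simp add: infsum_reindex inj_on_def o_def)
  qed
  have "seq_log N r x = - (1 / (2 * real N)) * (\<Sum>u\<in>range t \<inter> {0..<real N}. G u)"
    if r: "periodic_seq N r" "range r = range t" for r
  proof -
    have "(\<Sum>\<^sub>\<infinity>j\<in>UNIV - {i}. (1 - x) powr \<bar>r j - r i\<bar> / \<bar>r j - r i\<bar>) = G (r i)" for i
    proof -
      have inj: "inj r"
        by (rule periodic_seq_inj[OF r(1)])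
      have "range t - {r i} = r ` (UNIV - {i})"
        using inj r(2) by (auto simp: inj_eq)
      moreover have "inj_on r (UNIV - {i})"
        using inj by (rule inj_on_subset) simp
      ultimately show ?thesis
        unfolding G_def f_def by (simp add: infsum_reindex o_def)
    qed
    then show ?thesis
      using sum_over_period[OF assms(1) r(1), of G] G_shift r(2) by (simp add: seq_log_def)
  qed
  from this[OF assms(2)] this[OF assms(3)] assms(4) show ?thesis
    by simp
qed

text \<open>
  Listing the \<open>N\<close> points of the window \<open>[0, N)\<close> in increasing order and repeating that list with
  period \<open>N\<close> numbers all points increasingly.
\<close>

lemma periodic_seq_sorted:
  assumes "N \<ge> 1" "periodic_seq N t"
  obtains s where "strict_mono s" "periodic_seq N s" "range s = range t"
proof
  define U where "U = range t \<inter> {0..<real N}"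
  define l where "l = sorted_list_of_set U"
  define s where "s = (\<lambda>n. l ! nat (n mod int N) + of_int (n div int N) * real N)"
  have N: "0 < real N" "0 < int N"
    using assms(1) by simp_all
  note bij = bij_betw_period_window[OF assms, folded U_def]
  have fin: "finite U" and card: "card U = N"
    using bij_betw_finite[OF bij] bij_betw_same_card[OF bij] by simp_all
  have set_l: "set l = U" and len: "length l = N" and sorted: "sorted_wrt (<) l"
    using fin card unfolding l_def
    by (simp_all add: length_sorted_list_of_set strict_sorted_list_of_set)
  have idx: "nat (n mod int N) < N" for n
    using N by (simp add: nat_less_iff)
  have in_U: "l ! nat (n mod int N) \<in> U" for n
    using idx[of n] set_l len nth_mem by metis
  show mono: "strict_mono s"
  proof (rule strict_monoI)
    fix m n :: int assume "m < n"
    show "s m < s n"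
    proof (cases "m div int N = n div int N")
      case True
      have "m mod int N < n mod int N"
        using \<open>m < n\<close> True div_mult_mod_eq[of m "int N"] div_mult_mod_eq[of n "int N"]
        by (metis add_less_cancel_left)
      then have "nat (m mod int N) < nat (n mod int N)"
        using N by (subst nat_less_eq_zless) (simp_all only: pos_mod_sign)
      then show ?thesis
        using sorted_wrt_nth_less[OF sorted] idx len True by (simp add: s_def)
    next
      case False
      then have "m div int N + 1 \<le> n div int N"
        using \<open>m < n\<close> N zdiv_mono1[of m n "int N"] by simp
      then have "(of_int (m div int N) + 1) * real N \<le> of_int (n div int N) * real N"
        using N by (intro mult_right_mono) linarith+
      then show ?thesis
        using in_U[of m] in_U[of n] by (simp add: s_def U_def algebra_simps)
    qed
  qed
  show "periodic_seq N s"
    using strict_mono_imp_inj_on[OF mono] N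
    by (simp add: periodic_seq_def s_def algebra_simps)
  show "range s = range t"
  proof (intro subset_antisym subsetI)
    fix v assume "v \<in> range s"
    then show "v \<in> range t"
      using in_U periodic_seq_range_shift[OF assms(2)] by (auto simp: s_def U_def)
  next
    fix v assume v: "v \<in> range t"
    define m where "m = \<lfloor>v / real N\<rfloor>"
    have "v - of_int m * real N \<in> {0..<real N}"
      using floor_divide_lower[OF N(1), of v] floor_divide_upper[OF N(1), of v]
      unfolding m_def by (simp add: algebra_simps)
    then have "v - of_int m * real N \<in> set l"
      using periodic_seq_range_shift[OF assms(2) v, of "- m"] set_l by (simp add: U_def)
    then obtain k where k: "k < N" "l ! k = v - of_int m * real N"
      using len by (auto simp: in_set_conv_nth)
    have "s (int k + m * int N) = v"
      using k by (simp add: s_def)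
    then show "v \<in> range s"
      by blast
  qed
qed


section \<open>The energy of increasing sequences\<close>

lemma has_sum_sum:
  fixes f :: "'a \<Rightarrow> 'b \<Rightarrow> 'c :: topological_comm_monoid_add"
  assumes "finite I" "\<And>i. i \<in> I \<Longrightarrow> (f i has_sum S i) A"
  shows "((\<lambda>a. \<Sum>i\<in>I. f i a) has_sum (\<Sum>i\<in>I. S i)) A"
  using assms by (induction I rule: finite_induct) (auto intro!: has_sum_add)

text \<open>
  The distance to the \<open>k\<close>-th right neighbour is at least the first gap, which bounds the
  denominators, and at least \<open>k - N\<close>, which gives a geometric majorant.
\<close>

lemma pair_energy_summable:
  assumes "0 < q" "q < 1" "N \<ge> 1" "periodic_seq N s" "strict_mono s"
  shows "(\<lambda>k. pair_energy q (s (i + int k) - s i)) summable_on {1..}"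
proof (rule summable_on_comparison_test)
  define \<delta> where "\<delta> = s (i + 1) - s i"
  have \<delta>: "0 < \<delta>"
    using strict_monoD[OF assms(5), of i "i + 1"] by (simp add: \<delta>_def)
  have "(\<lambda>k. q powr (- real N) / \<delta> * q ^ k) summable_on UNIV"
    using assms(1,2) \<delta>
    by (intro summable_nonneg_imp_summable_on summable_mult summable_geometric) simp_all
  then show "(\<lambda>k. q powr (- real N) / \<delta> * q ^ k) summable_on {1..}"
    by (rule summable_on_subset_banach) simp
  fix k :: nat assume "k \<in> {1..}"
  then have "i + 1 \<le> i + int k"
    by simp
  then have ge_\<delta>: "\<delta> \<le> s (i + int k) - s i"
    using strict_mono_less_eq[OF assms(5), of "i + 1" "i + int k"] by (simp add: \<delta>_def)
  have "i + int (k div N) * int N \<le> i + int k"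
    by (simp add: of_nat_mult[symmetric] del: of_nat_mult)
  then have "s i + real (k div N) * real N \<le> s (i + int k)"
    using strict_mono_less_eq[OF assms(5)] periodic_seq_shift[OF assms(4), of i "int (k div N)"]
    by (metis of_int_of_nat_eq)
  moreover have "real k \<le> real (k div N) * real N + real N"
  proof -
    have "k \<le> k div N * N + N"
      using assms(3) div_mult_mod_eq[of k N] mod_less_divisor[of N k] by linarith
    then show ?thesis
      by (metis of_nat_add of_nat_le_iff of_nat_mult)
  qed
  ultimately have "real k - real N \<le> s (i + int k) - s i"
    by linarith
  then have "q powr (s (i + int k) - s i) \<le> q powr (real k - real N)"
    using assms(1,2) by (intro powr_mono') simp_all
  also have "\<dots> = q powr (- real N) * q ^ k"
    using assms(1) by (simp add: powr_diff powr_minus powr_realpow field_simps)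
  finally have "q powr (s (i + int k) - s i) / (s (i + int k) - s i) \<le> q powr (- real N) * q ^ k / \<delta>"
    using \<delta> ge_\<delta> assms(1) by (intro frac_le) simp_all
  then show "pair_energy q (s (i + int k) - s i) \<le> q powr (- real N) / \<delta> * q ^ k"
    by (simp add: pair_energy_def)
  show "0 \<le> pair_energy q (s (i + int k) - s i)"
    using \<delta> ge_\<delta> by (intro pair_energy_nonneg) simp
qed

text \<open>
  Splitting the other points into left and right neighbours and summing over a period, the pairs
  at index distance \<open>k\<close> are met twice, once from either end; this cancels the factor \<open>2\<close> in the
  normalisation.
\<close>

lemma has_sum_seq_log:
  assumes "0 < x" "x < 1" "N \<ge> 1" "periodic_seq N s" "strict_mono s"
  shows "((\<lambda>k. \<Sum>i\<in>{1..int N}. pair_energy (1 - x) (s (i + int k) - s i))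
           has_sum (- real N * seq_log N s x)) {1..}"
proof -
  define right where "right = (\<lambda>i k. pair_energy (1 - x) (s (i + int k) - s i))"
  define left where "left = (\<lambda>i k. pair_energy (1 - x) (s i - s (i - int k)))"
  define R where "R = (\<lambda>i. infsum (right i) {1..})"
  define L where "L = (\<lambda>i. infsum (left i) {1..})"
  have q: "0 < 1 - x" "1 - x < 1"
    using assms(1,2) by simp_all
  have reflect: "strict_mono (\<lambda>n. - s (- n))"
    using assms(5) by (simp add: strict_mono_def)
  have R: "(right i has_sum R i) {1..}" for i
    unfolding R_def right_def
    by (intro has_sum_infsum pair_energy_summable[OF q assms(3-5)])
  have L: "(left i has_sum L i) {1..}" for i
    using pair_energy_summable[OF q assms(3) periodic_seq_reflect[OF assms(4)] reflect, of "- i"]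
    unfolding L_def left_def by (intro has_sum_infsum) (simp add: algebra_simps)
  have inner: "(\<Sum>\<^sub>\<infinity>j\<in>UNIV - {i}. (1 - x) powr \<bar>s j - s i\<bar> / \<bar>s j - s i\<bar>) = R i + L i" for i
  proof -
    let ?f = "\<lambda>j. (1 - x) powr \<bar>s j - s i\<bar> / \<bar>s j - s i\<bar>"
    have s_abs: "\<bar>s (i + int k) - s i\<bar> = s (i + int k) - s i"
      "\<bar>s (i - int k) - s i\<bar> = s i - s (i - int k)" for k
      using strict_mono_less_eq[OF assms(5), of i "i + int k"]
        strict_mono_less_eq[OF assms(5), of "i - int k" i] by simp_all
    have "(?f has_sum R i) ((\<lambda>k. i + int k) ` {1..}) \<longleftrightarrow> (right i has_sum R i) {1..}"
      using s_abs
      by (subst has_sum_reindex) (auto simp: inj_on_def right_def pair_energy_def intro!: has_sum_cong)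
    moreover have "(?f has_sum L i) ((\<lambda>k. i - int k) ` {1..}) \<longleftrightarrow> (left i has_sum L i) {1..}"
      using s_abs
      by (subst has_sum_reindex)
         (auto simp: inj_on_def left_def pair_energy_def intro!: has_sum_cong)
    moreover have "UNIV - {i} = (\<lambda>k. i + int k) ` {1..} \<union> (\<lambda>k. i - int k) ` {1..}"
    proof (intro subset_antisym subsetI)
      fix j assume "j \<in> UNIV - {i}"
      then consider "i < j" | "j < i"
        by force
      then show "j \<in> (\<lambda>k. i + int k) ` {1..} \<union> (\<lambda>k. i - int k) ` {1..}"
      proof cases
        case 1
        then show ?thesis
          by (intro UnI1 image_eqI[where x = "nat (j - i)"]) auto
      next
        case 2
        then show ?thesis
          by (intro UnI2 image_eqI[where x = "nat (i - j)"]) auto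
      qed
    qed auto
    ultimately show ?thesis
      using R[of i] L[of i] by (auto intro!: infsumI has_sum_Un_disjoint)
  qed
  have right_sum: "((\<lambda>k. \<Sum>i\<in>{1..int N}. right i k) has_sum (\<Sum>i\<in>{1..int N}. R i)) {1..}"
    by (intro has_sum_sum R) simp
  have left_sum: "((\<lambda>k. \<Sum>i\<in>{1..int N}. left i k) has_sum (\<Sum>i\<in>{1..int N}. L i)) {1..}"
    by (intro has_sum_sum L) simp
  have "(\<Sum>i\<in>{1..int N}. left i k) = (\<Sum>i\<in>{1..int N}. right i k)" for k
  proof -
    have "right (i + int N) k = right i k" for i
      using periodic_seq_shift[OF assms(4), of i 1] periodic_seq_shift[OF assms(4), of "i + int k" 1]
      by (simp add: right_def algebra_simps)
    then have "(\<Sum>i\<in>{1..int N}. right (i + - int k) k) = (\<Sum>i\<in>{1..int N}. right i k)"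
      by (rule sum_periodic_shift)
    then show ?thesis
      by (simp add: left_def right_def)
  qed
  then have "(\<Sum>i\<in>{1..int N}. L i) = (\<Sum>i\<in>{1..int N}. R i)"
    using left_sum right_sum by (simp add: has_sum_unique)
  then have "- real N * seq_log N s x = (\<Sum>i\<in>{1..int N}. R i)"
    using assms(3) by (simp add: seq_log_def inner sum.distrib)
  then show ?thesis
    using right_sum by (simp add: right_def)
qed

text \<open>
  Jensen's inequality for the \<open>N\<close> distances at index distance \<open>k\<close>, obtained by summing the
  tangent inequality at their mean \<open>k\<close>: the linear terms cancel.
\<close>

lemma sum_pair_energy_ge:
  assumes "0 < q" "periodic_seq N s" "strict_mono s" "k \<ge> 1"
  shows "real N * pair_energy q (real k) \<le> (\<Sum>i\<in>{1..int N}. pair_energy q (s (i + int k) - s i))"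
    and "(\<Sum>i\<in>{1..int N}. pair_energy q (s (i + int k) - s i)) = real N * pair_energy q (real k)
      \<Longrightarrow> i \<in> {1..int N} \<Longrightarrow> s (i + int k) - s i = real k"
proof -
  let ?d = "\<lambda>i. s (i + int k) - s i"
  define tangent where "tangent = (\<lambda>d. pair_energy q (real k) * (1 + (ln q - 1 / real k) * (d - real k)))"
  have k: "0 < real k"
    using assms(4) by simp
  have d: "0 < ?d i" for i
    using strict_monoD[OF assms(3), of i "i + int k"] assms(4) by simp
  have le: "tangent (?d i) \<le> pair_energy q (?d i)" for i
    unfolding tangent_def by (rule pair_energy_tangent(1)[OF assms(1) k d])
  have "(\<Sum>i\<in>{1..int N}. ?d i - real k) = 0"
    unfolding sum_subtractf[of ?d] sum_spacing[OF assms(2)] by simp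
  then have tangent_sum: "(\<Sum>i\<in>{1..int N}. tangent (?d i)) = real N * pair_energy q (real k)"
    unfolding tangent_def sum_distrib_left[symmetric] sum.distrib by simp
  show "real N * pair_energy q (real k) \<le> (\<Sum>i\<in>{1..int N}. pair_energy q (?d i))"
    unfolding tangent_sum[symmetric] by (intro sum_mono le)
  assume "(\<Sum>i\<in>{1..int N}. pair_energy q (?d i)) = real N * pair_energy q (real k)"
    and i: "i \<in> {1..int N}"
  then have "(\<Sum>i\<in>{1..int N}. pair_energy q (?d i) - tangent (?d i)) = 0"
    by (simp add: sum_subtractf tangent_sum)
  then have "tangent (?d i) = pair_energy q (?d i)"
    using i le by (subst (asm) sum_nonneg_eq_0_iff) auto
  then show "?d i = real k"
    unfolding tangent_def by (rule pair_energy_tangent(2)[OF assms(1) k d])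
qed

text \<open>
  The difference \<open>N * (ln x - seq_log N s x)\<close> is a series whose terms are nonnegative by Jensen's
  inequality.  If it vanishes then so does its term at \<open>k = 1\<close>, which is the one that sees the
  consecutive gaps.
\<close>

lemma seq_log_increasing_le:
  assumes "0 < x" "x < 1" "N \<ge> 1" "periodic_seq N s" "strict_mono s"
  shows "seq_log N s x \<le> ln x"
    and "seq_log N s x = ln x \<Longrightarrow> s (i + 1) = s i + 1"
proof -
  define q where "q = 1 - x"
  have q: "0 < q" "q < 1"
    using assms(1,2) by (simp_all add: q_def)
  let ?A = "\<lambda>k. \<Sum>i\<in>{1..int N}. pair_energy q (s (i + int k) - s i)"
  have "((\<lambda>k. real N * pair_energy q (real k)) has_sum (real N * - ln (1 - q))) {1..}"
    by (intro has_sum_cmult_right pair_energy_has_sum q)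
  then have B: "((\<lambda>k. - (real N * pair_energy q (real k))) has_sum (real N * ln x)) {1..}"
    by (simp add: has_sum_uminus q_def)
  note A = has_sum_seq_log[OF assms, folded q_def]
  have diff: "((\<lambda>k. ?A k - real N * pair_energy q (real k))
      has_sum (real N * (ln x - seq_log N s x))) {1..}"
    using has_sum_add[OF A B] by (simp add: algebra_simps)
  have nonneg: "0 \<le> ?A k - real N * pair_energy q (real k)" if "k \<in> {1..}" for k
    using sum_pair_energy_ge(1)[OF q(1) assms(4,5)] that by simp
  have "0 \<le> real N * (ln x - seq_log N s x)"
    by (rule has_sum_nonneg[OF diff nonneg])
  then show "seq_log N s x \<le> ln x"
    using assms(3) by (simp add: zero_le_mult_iff)
  assume "seq_log N s x = ln x"
  then have "infsum (\<lambda>k. ?A k - real N * pair_energy q (real k)) {1..} = 0"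
    using infsumI[OF diff] by simp
  then have "?A 1 - real N * pair_energy q (real 1) = 0"
    using diff nonneg
    by (intro nonneg_infsum_le_0D[where f = "\<lambda>k. ?A k - real N * pair_energy q (real k)"])
       (auto simp: summable_on_def)
  then have gap: "s (j + 1) - s j = 1" if "j \<in> {1..int N}" for j
    using sum_pair_energy_ge(2)[OF q(1) assms(4,5), of 1 j] that by simp
  obtain j m where "j \<in> {1..int N}" and i: "i = j + m * int N"
    using int_period_decomposition[OF assms(3)] .
  then show "s (i + 1) = s i + 1"
    using gap[of j] periodic_seq_shift[OF assms(4), of j m] periodic_seq_shift[OF assms(4), of "j + 1" m]
    by (simp add: i algebra_simps)
qed

lemma periodic_seq_translate: "periodic_seq N (\<lambda>n. of_int n + a)"
  by (simp add: periodic_seq_def inj_def)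

lemma seq_log_translate:
  assumes "0 < x" "x < 1" "N \<ge> 1"
  shows "seq_log N (\<lambda>n. of_int n + a) x = ln x"
proof -
  have "((\<lambda>k. real N * pair_energy (1 - x) (real k))
      has_sum (- real N * seq_log N (\<lambda>n. of_int n + a) x)) {1..}"
    using has_sum_seq_log[OF assms periodic_seq_translate[of N a]] by (simp add: strict_mono_def)
  moreover have "((\<lambda>k. real N * pair_energy (1 - x) (real k)) has_sum (real N * - ln x)) {1..}"
    using pair_energy_has_sum[of "1 - x"] assms by (intro has_sum_cmult_right) simp
  ultimately have "- real N * seq_log N (\<lambda>n. of_int n + a) x = real N * - ln x"
    by (rule has_sum_unique)
  then show ?thesis
    using assms(3) by simp
qed

lemma range_translate: "range (\<lambda>n. of_int n + a) = (\<lambda>z. z + a) ` (\<int> :: real set)"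
  by (auto simp: Ints_def)


section \<open>The maximum\<close>

theorem theorem2p1:
  fixes x :: real and N :: nat
  assumes "0 < x" and "x < 1" and "N \<ge> 1"
  shows "is_maximum (ln x) {seq_log N t x | t. periodic_seq N t} \<and>
         (\<forall>t. periodic_seq N t \<longrightarrow>
            (seq_log N t x = ln x \<longleftrightarrow> (\<exists>a::real. range t = (\<lambda>z. z + a) ` \<int>)))"
proof (intro conjI allI impI)
  have "seq_log N t x \<le> ln x" if t: "periodic_seq N t" for t
  proof -
    obtain s where s: "strict_mono s" "periodic_seq N s" "range s = range t"
      using periodic_seq_sorted[OF assms(3) t] .
    then show ?thesis
      using seq_log_increasing_le(1)[OF assms s(2,1)] seq_log_cong_range[OF assms(3) s(2) t s(3)]
      by simp
  qed
  moreover have "ln x \<in> {seq_log N t x | t. periodic_seq N t}"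
    using seq_log_translate[OF assms, of 0, symmetric] periodic_seq_translate[of N 0] by blast
  ultimately show "is_maximum (ln x) {seq_log N t x | t. periodic_seq N t}"
    unfolding is_maximum_def by blast
next
  fix t assume t: "periodic_seq N t"
  show "seq_log N t x = ln x \<longleftrightarrow> (\<exists>a::real. range t = (\<lambda>z. z + a) ` \<int>)"
  proof
    assume eq: "seq_log N t x = ln x"
    obtain s where s: "strict_mono s" "periodic_seq N s" "range s = range t"
      using periodic_seq_sorted[OF assms(3) t] .
    have step: "s (i + 1) = s i + 1" for i
      using seq_log_increasing_le(2)[OF assms s(2,1)] seq_log_cong_range[OF assms(3) s(2) t s(3)] eq
      by simp
    have "s n = of_int n + s 0" for n
    proof (induction n rule: int_induct[where k = 0])
      case (step2 n)
      then show ?case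
        using step[of "n - 1"] by simp
    qed (simp_all add: step)
    then have "range t = range (\<lambda>n. of_int n + s 0)"
      using s(3) by (metis (no_types, lifting) image_cong)
    then show "\<exists>a::real. range t = (\<lambda>z. z + a) ` \<int>"
      using range_translate by metis
  next
    assume "\<exists>a::real. range t = (\<lambda>z. z + a) ` \<int>"
    then obtain a where "range t = range (\<lambda>n. of_int n + a)"
      using range_translate by metis
    then show "seq_log N t x = ln x"
      using seq_log_cong_range[OF assms(3) t periodic_seq_translate] seq_log_translate[OF assms]
      by simp
  qed
qed

end
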